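(* For every odd integer $d\ge 3$ and every prime power $q\ge d+2$, $$M(q,q-d-1)\ \ge\ \mathcal{S}_d(q)+N^m_{\frac{d+3}{2},\frac{d+1}{2}}(q).$$
   Context: For permutations $\pi,\sigma$ of the same $n$ symbols, the Hamming distance $hd(\pi,\sigma)$ is the number of positions $x$ with $\pi(x)\ne\sigma(x)$. $M(n,D)$ is the maximum size of a set of permutations on $n$ symbols in which any two distinct permutations have Hamming distance at least $D$. Let $q$ be a prime power, $\mathbb{F}_q$ the field with $q$ elements and $\mathcal{P}^1(\mathbb{F}_q)=\mathbb{F}_q\cup\{\infty\}$. Let $V,U$ be nonzero polynomials over $\mathbb{F}_q$ with $\gcd(V,U)=1$, of degrees $v,u$ and leading coefficients $a_v,b_u$. The rational function $V(x)/U(x)$ is evaluated on $\mathcal{P}^1(\mathbb{F}_q)$ as follows: at $a\in\mathbb{F}_q$ its value is $V(a)/U(a)$, understood as $\infty$ if $U(a)=0$; at $\infty$ its value is $\infty$ if $v>u$, $0$ if $v<u$, and $a_v/b_v$ if $v=u$. It is a permutation rational function (PRF) if it permutes $\mathcal{P}^1(\mathbb{F}_q)$. $P_{v,u}(q)$ is the set of PRFs $V(x)/U(x)$ (as rational functions, so $V/U$ and $(cV)/(cU)$ with $c\in\mathbb{F}_q\setminus\{0\}$ are the same element) with $\deg V=v$ and $\deg U=u$, and $N_{v,u}(q)=|P_{v,u}(q)|$. $N^m_{v,u}(q)$ is the number of PRFs $V(x)/U(x)$ in $P_{v,u}(q)$ with both $V$ and $U$ monic. For odd $d$, $\mathcal{S}_d(q)=\sum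 N_{v,u}(q)$, the sum being over all pairs $(v,u)$ of non-negative integers such that: $v\le (d+1)/2$ if $v>u$; $u\le (d-3)/2$ if $v<u$; and $v=u\le (d-3)/2$ if $v=u$. *)

theory Defs
  imports
    "HOL-Computational_Algebra.Polynomial"
    "HOL-Computational_Algebra.Fraction_Field"
    "HOL-Combinatorics.Permutations"
    "HOL-Number_Theory.Prime_Powers"
begin

definition hamming_dist :: "nat \<Rightarrow> (nat \<Rightarrow> nat) \<Rightarrow> (nat \<Rightarrow> nat) \<Rightarrow> nat" where
  "hamming_dist n \<pi> \<sigma> = card {x \<in> {..<n}. \<pi> x \<noteq> \<sigma> x}"

definition is_perm_array :: "nat \<Rightarrow> nat \<Rightarrow> (nat \<Rightarrow> nat) set \<Rightarrow> bool" where
  "is_perm_array n D C \<longleftrightarrow>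
     (\<forall>\<pi>\<in>C. \<pi> permutes {..<n}) \<and>
     (\<forall>\<pi>\<in>C. \<forall>\<sigma>\<in>C. \<pi> \<noteq> \<sigma> \<longrightarrow> D \<le> hamming_dist n \<pi> \<sigma>)"

definition M :: "nat \<Rightarrow> nat \<Rightarrow> nat" where
  "M n D = Max (card ` {C. is_perm_array n D C})"

text \<open>The maximum is taken over a finite nonempty set.\<close>

lemma finite_perm_arrays: "finite {C. is_perm_array n D C}"
  by (rule finite_subset[of _ "Pow {\<pi>. \<pi> permutes {..<n}}"])
     (auto simp: is_perm_array_def finite_permutations)

lemma perm_arrays_nonempty: "{} \<in> {C. is_perm_array n D C}"
  by (simp add: is_perm_array_def)

text \<open>The projective line over a field, with \<open>None\<close> as the point at infinity.\<close>

type_synonym 'a proj_line = "'a option"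

fun ratfun_eval :: "'a::field poly \<Rightarrow> 'a poly \<Rightarrow> 'a proj_line \<Rightarrow> 'a proj_line" where
  "ratfun_eval V U (Some a) =
     (if poly U a = 0 then None else Some (poly V a / poly U a))"
| "ratfun_eval V U None =
     (if degree V > degree U then None
      else if degree V < degree U then Some 0
      else Some (lead_coeff V / lead_coeff U))"

definition is_PRF :: "'a::field poly \<Rightarrow> 'a poly \<Rightarrow> bool" where
  "is_PRF V U \<longleftrightarrow> V \<noteq> 0 \<and> U \<noteq> 0 \<and> coprime V U \<and> bij (ratfun_eval V U)"

text \<open>
  Elements are rational functions, i.e. members of the fraction field of the polynomial ring,
  so that \<open>V / U\<close> and \<open>(c V) / (c U)\<close> are counted once. The argument of type
  \<open>'a itself\<close> in the counting functions selects the field.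
\<close>

definition PRFs :: "nat \<Rightarrow> nat \<Rightarrow> 'a::field poly fract set" where
  "PRFs v u = {Fract V U | V U. is_PRF V U \<and> degree V = v \<and> degree U = u}"

definition monic_PRFs :: "nat \<Rightarrow> nat \<Rightarrow> 'a::field poly fract set" where
  "monic_PRFs v u = {Fract V U | V U. is_PRF V U \<and> degree V = v \<and> degree U = u \<and>
     lead_coeff V = 1 \<and> lead_coeff U = 1}"

definition N_PRF :: "'a::{field,finite} itself \<Rightarrow> nat \<Rightarrow> nat \<Rightarrow> nat" where
  "N_PRF _ v u = card (PRFs v u :: 'a poly fract set)"

definition N_monic :: "'a::{field,finite} itself \<Rightarrow> nat \<Rightarrow> nat \<Rightarrow> nat" where
  "N_monic _ v u = card (monic_PRFs v u :: 'a poly fract set)"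

text \<open>
  The bounds \<open>v \<le> (d + 1) / 2\<close> and \<open>u \<le> (d - 3) / 2\<close> are written without
  denominators and without truncated subtraction.
\<close>

definition S_index :: "nat \<Rightarrow> (nat \<times> nat) set" where
  "S_index d = {(v, u).
     (v > u \<and> 2 * v \<le> d + 1) \<or>
     (v < u \<and> 2 * u + 3 \<le> d) \<or>
     (v = u \<and> 2 * u + 3 \<le> d)}"

definition S_PRF :: "'a::{field,finite} itself \<Rightarrow> nat \<Rightarrow> nat" where
  "S_PRF F d = (\<Sum>(v, u)\<in>S_index d. N_PRF F v u)"

lemma finite_S_index: "finite (S_index d)"
  by (rule finite_subset[of _ "{..d + 1} \<times> {..d + 1}"]) (auto simp: S_index_def)

lemma finite_PRFs: "finite (PRFs v u :: 'a::{field,finite} poly fract set)"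
proof -
  have fin: "finite {p :: 'a poly. degree p \<le> n}" for n
  proof (rule finite_imageD)
    show "finite ((\<lambda>p. map (coeff p) [0..<Suc n]) ` {p :: 'a poly. degree p \<le> n})"
      by (rule finite_subset[OF _ finite_lists_length_eq[of "UNIV :: 'a set" "Suc n"]]) auto
    show "inj_on (\<lambda>p. map (coeff p) [0..<Suc n]) {p :: 'a poly. degree p \<le> n}"
    proof (rule inj_onI, rule poly_eqI)
      fix p r :: "'a poly" and i
      assume pr: "p \<in> {p. degree p \<le> n}" "r \<in> {p. degree p \<le> n}"
        and eq: "map (coeff p) [0..<Suc n] = map (coeff r) [0..<Suc n]"
      show "coeff p i = coeff r i"
      proof (cases "i \<le> n")
        case True
        then have "i \<in> set [0..<Suc n]" by auto
        with eq show ?thesis unfolding map_eq_conv by blast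
      next
        case False
        with pr show ?thesis by (simp add: coeff_eq_0)
      qed
    qed
  qed
  have "PRFs v u \<subseteq> (\<lambda>(V, U). Fract V U) ` ({p :: 'a poly. degree p \<le> v} \<times> {p. degree p \<le> u})"
    by (force simp: PRFs_def)
  then show ?thesis
    by (rule finite_subset) (intro finite_imageI finite_cartesian_product fin)
qed

end

theory Submission
  imports Defs
begin

text \<open>
  A permutation of the projective line contracts to a permutation of the field: delete the point
  at infinity from its cycle. Two contracted functions \<open>V/U\<close> and \<open>W/T\<close> agree only at roots of
  \<open>V T - U W\<close> or at a pole of exactly one of them, and a permutation rational function has a pole
  in the field only if it moves infinity, i.e. if \<open>deg V \<le> deg U\<close>. In each combination of the
  degrees allowed by \<open>S_index d\<close> and \<open>((d + 3) / 2, (d + 1) / 2)\<close> this gives at most \<open>d + 1\<close>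
  agreements; for two functions of the latter kind the leading terms of \<open>V T\<close> and \<open>U W\<close> cancel
  because all polynomials are monic.
\<close>

section \<open>Contraction\<close>

text \<open>For injective \<open>f\<close>, a point sent to infinity forces \<open>f None\<close> to
  be finite, so \<open>the\<close> only meets a \<open>Some\<close>.\<close>

definition contract :: "('a option \<Rightarrow> 'a option) \<Rightarrow> 'a \<Rightarrow> 'a" where
  "contract f a = (case f (Some a) of None \<Rightarrow> the (f None) | Some b \<Rightarrow> b)"

lemma inj_contract:
  assumes "inj f"
  shows "inj (contract f)"
proof (rule injI)
  fix a b
  assume eq: "contract f a = contract f b"
  have inj: "f x = f y \<Longrightarrow> x = y" for x y
    using assms by (simp add: inj_eq)
  show "a = b"
    using eq inj[of "Some a" "Some b"] inj[of "Some a" None] inj[of "Some b" None]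
    by (cases "f (Some a)"; cases "f (Some b)"; cases "f None") (auto simp: contract_def)
qed

text \<open>Away from the poles contraction changes nothing, and equality of the two quotients
  cross-multiplies to a root of \<open>V * T - U * W\<close>.\<close>

lemma contract_agree_subset:
  "{a. contract (ratfun_eval V U) a = contract (ratfun_eval W T) a}
     \<subseteq> {a. poly (V * T - U * W) a = 0} \<union> {a. poly U a = 0} \<union> {a. poly T a = 0}"
  by (auto simp: contract_def field_simps split: if_splits)

text \<open>A pole is a preimage of infinity: injectivity allows only one, and if
  \<open>degree U < degree V\<close> that preimage is infinity itself.\<close>

lemma card_poles_le:
  assumes "is_PRF V U"
  shows "card {a. poly U a = 0} \<le> (if degree U < degree V then 0 else 1)"
proof -
  have inj: "inj (ratfun_eval V U)"
    using assms by (simp add: is_PRF_def bij_is_inj)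
  have "a = b" if "poly U a = 0" "poly U b = 0" for a b
    using injD[OF inj, of "Some a" "Some b"] that by simp
  moreover have "finite {a. poly U a = 0}"
    using assms by (simp add: is_PRF_def poly_roots_finite)
  ultimately have "card {a. poly U a = 0} \<le> 1"
    by (simp add: card_le_Suc0_iff_eq)
  moreover have "poly U a \<noteq> 0" if "degree U < degree V" for a
    using injD[OF inj, of "Some a" None] that by auto
  ultimately show ?thesis
    by auto
qed

lemma card_contract_agree_le:
  fixes V U W T :: "'a::{field,finite} poly"
  assumes "is_PRF V U" "is_PRF W T" "V * T \<noteq> U * W"
  shows "card {a. contract (ratfun_eval V U) a = contract (ratfun_eval W T) a}
     \<le> degree (V * T - U * W) + (if degree U < degree V then 0 else 1)
        + (if degree T < degree W then 0 else 1)"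
proof -
  have "card {a. contract (ratfun_eval V U) a = contract (ratfun_eval W T) a}
      \<le> card ({a. poly (V * T - U * W) a = 0} \<union> {a. poly U a = 0} \<union> {a. poly T a = 0})"
    by (rule card_mono[OF _ contract_agree_subset]) simp
  also have "\<dots> \<le> card {a. poly (V * T - U * W) a = 0} + card {a. poly U a = 0}
      + card {a. poly T a = 0}"
    by (meson add_le_mono card_Un_le le_refl order_trans)
  also have "\<dots> \<le> degree (V * T - U * W) + (if degree U < degree V then 0 else 1)
      + (if degree T < degree W then 0 else 1)"
    using assms by (intro add_mono card_poles_le card_poly_roots_bound) auto
  finally show ?thesis .
qed

text \<open>Being monic is a property of the pair and not of the fraction, so the condition is
  placed on representatives.\<close>

definition admissible :: "nat \<Rightarrow> 'a::field poly \<Rightarrow> 'a poly \<Rightarrow> bool" where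
  "admissible d V U \<longleftrightarrow> is_PRF V U \<and>
     ((degree V, degree U) \<in> S_index d \<or>
      degree V = (d + 3) div 2 \<and> degree U = (d + 1) div 2 \<and> lead_coeff V = 1 \<and> lead_coeff U = 1)"

lemma degree_cross_diff_le:
  assumes "odd d" and V: "admissible d V U" and W: "admissible d W T"
  shows "degree (V * T - U * W) + (if degree U < degree V then 0 else 1)
     + (if degree T < degree W then 0 else 1) \<le> d + 1"
proof -
  obtain k where d: "d = 2 * k + 1"
    using \<open>odd d\<close> by (rule oddE)
  have nz: "V \<noteq> 0" "U \<noteq> 0" "W \<noteq> 0" "T \<noteq> 0"
    using V W by (auto simp: admissible_def is_PRF_def)
  have deg: "degree (V * T) = degree V + degree T" "degree (U * W) = degree U + degree W"
    using nz by (simp_all add: degree_mult_eq)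
  show ?thesis
  \<comment> \<open>With \<open>d = 2 * k + 1\<close>, pairs in \<open>S_index d\<close> have
    numerator degree at most \<open>k + 1\<close>, so degree \<open>k + 2\<close> singles out the
    monic kind. Only for two of these does the naive degree bound, \<open>2 * k + 3\<close>, exceed
    \<open>d + 1\<close>.\<close>
  proof (cases "degree V = k + 2 \<and> degree W = k + 2")
    case True
    with V W have degs: "degree V = k + 2" "degree U = k + 1" "degree W = k + 2" "degree T = k + 1"
      and lead: "lead_coeff V = 1" "lead_coeff U = 1" "lead_coeff W = 1" "lead_coeff T = 1"
      by (auto simp: admissible_def S_index_def d)
    have "lead_coeff (V * T) = 1" "lead_coeff (U * W) = 1"
      by (simp_all only: lead_coeff_mult lead mult_1)
    then have top: "coeff (V * T) (2 * k + 3) = 1" "coeff (U * W) (2 * k + 3) = 1"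
      unfolding deg degs by (simp_all add: numeral_eq_Suc mult_2)
    have "degree (V * T - U * W) < 2 * k + 3"
    proof (rule degree_lessI)
      show "\<forall>i\<ge>2 * k + 3. coeff (V * T - U * W) i = 0"
      proof (intro allI impI)
        fix i assume "2 * k + 3 \<le> i"
        then consider "i = 2 * k + 3" | "2 * k + 3 < i" by linarith
        then show "coeff (V * T - U * W) i = 0"
        proof cases
          case 1
          with top show ?thesis by simp
        next
          case 2
          with degs have "degree (V * T) < i" "degree (U * W) < i"
            unfolding deg by simp_all
          then show ?thesis by (simp add: coeff_eq_0)
        qed
      qed
    qed simp
    with degs show ?thesis by (simp add: d)
  next
    case False
    \<comment> \<open>The extreme case is one monic pair of degrees \<open>(k + 2, k + 1)\<close>
      against degrees \<open>(k + 1, k)\<close>, or against \<open>(k - 1, k - 1)\<close> with one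
      pole: both give \<open>2 * k + 2\<close>.\<close>
    have "degree (V * T - U * W) \<le> max (degree V + degree T) (degree U + degree W)"
      using degree_diff_le_max[of "V * T" "U * W"] by (simp add: deg)
    with False V W show ?thesis
      by (auto simp: admissible_def S_index_def d max_def split: if_splits)
  qed
qed

section \<open>Degrees of rational functions\<close>

lemma coprime_poly_bezout:
  fixes p r :: "'a::field poly"
  assumes "coprime p r"
  shows "\<exists>a b. a * p + b * r = 1"
  using assms
\<comment> \<open>Euclid's algorithm; the \<open>Suc\<close> ranks nonzero constants above the zero
  polynomial, whose degree is also 0.\<close>
proof (induction "if r = 0 then 0 else Suc (degree r)" arbitrary: p r rule: less_induct)
  case less
  show ?case
  proof (cases "r = 0")
    case True
    with less.prems have "is_unit p" by simp
    then obtain a where "1 = p * a" by (rule dvdE)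
    then have "a * p + 0 * r = 1" by (simp add: mult.commute)
    then show ?thesis by blast
  next
    case False
    have "coprime r (p mod r)"
      using less.prems by (auto simp: coprime_def dvd_mod_iff)
    moreover have "(if p mod r = 0 then 0 else Suc (degree (p mod r)))
        < (if r = 0 then 0 else Suc (degree r))"
      using False degree_mod_less[of r p] by auto
    ultimately obtain a b where "a * r + b * (p mod r) = 1"
      using less.hyps by blast
    moreover have "p mod r = p - p div r * r"
      by (simp add: minus_div_mult_eq_mod)
    ultimately have "b * p + (a - b * (p div r)) * r = 1"
      by (simp add: algebra_simps)
    then show ?thesis by blast
  qed
qed

lemma coprime_poly_dvd_mult:
  fixes p r s :: "'a::field poly"
  assumes "coprime p r" "p dvd r * s"
  shows "p dvd s"
proof -
  obtain a b where "a * p + b * r = 1"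
    using coprime_poly_bezout[OF assms(1)] by blast
  then have "s = (a * p + b * r) * s" by simp
  then have "s = p * (a * s) + b * (r * s)" by (simp add: algebra_simps)
  with assms(2) show ?thesis by (metis dvd_add dvd_mult dvd_triv_left)
qed

text \<open>By coprimality the numerators divide each other. Hence the degrees belong to the
  fraction, and sets \<open>PRFs v u\<close> for different pairs cannot overlap.\<close>

lemma degree_eq_of_cross_eq:
  fixes V U W T :: "'a::field poly"
  assumes "is_PRF V U" "is_PRF W T" "V * T = U * W"
  shows "degree V = degree W \<and> degree U = degree T"
proof -
  have nz: "V \<noteq> 0" "U \<noteq> 0" "W \<noteq> 0" "T \<noteq> 0" and cop: "coprime V U" "coprime W T"
    using assms by (auto simp: is_PRF_def)
  have "V dvd U * W" "W dvd T * V"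
    using assms(3) by (metis dvd_triv_left, metis dvd_triv_right mult.commute)
  with cop have "V dvd W" "W dvd V"
    by (auto intro: coprime_poly_dvd_mult)
  with nz have "degree V = degree W"
    by (simp add: dvd_imp_degree_le order_antisym)
  moreover have "degree V + degree T = degree U + degree W"
    using assms(3) nz by (metis degree_mult_eq)
  ultimately show ?thesis by simp
qed

lemma Fract_eq_PRF_iff:
  assumes "is_PRF V U" "is_PRF W T"
  shows "Fract V U = Fract W T \<longleftrightarrow> V * T = U * W"
  using assms by (auto simp: is_PRF_def eq_fract mult.commute)

lemma PRFs_disjoint:
  assumes "(v, u) \<noteq> (w, t)"
  shows "PRFs v u \<inter> PRFs w t = {}"
  using assms degree_eq_of_cross_eq Fract_eq_PRF_iff unfolding PRFs_def by blast

lemma monic_PRFs_subset: "monic_PRFs v u \<subseteq> PRFs v u"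
  by (auto simp: monic_PRFs_def PRFs_def)

section \<open>Permutation arrays\<close>

lemma card_le_M:
  assumes "is_perm_array n D C"
  shows "card C \<le> M n D"
  unfolding M_def using assms finite_perm_arrays by (intro Max_ge) auto

text \<open>A family of permutations of a type with \<open>q\<close> elements is relabelled by a bijection to
  \<open>{..<q}\<close>. Since \<open>m < q\<close>, distinct members stay distinct.\<close>

lemma card_le_M_of_agree_le:
  fixes F :: "'i \<Rightarrow> 'a::finite \<Rightarrow> 'a"
  assumes q: "card (UNIV :: 'a set) = q" and "m < q"
    and inj: "\<And>x. x \<in> X \<Longrightarrow> inj (F x)"
    and agree: "\<And>x y. x \<in> X \<Longrightarrow> y \<in> X \<Longrightarrow> x \<noteq> y \<Longrightarrow> card {a. F x a = F y a} \<le> m"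
  shows "card X \<le> M q (q - m)"
proof -
  obtain h :: "nat \<Rightarrow> 'a" where h: "bij_betw h {..<q} UNIV"
    using ex_bij_betw_nat_finite[of "UNIV :: 'a set"] q by (auto simp: lessThan_atLeast0)
  define g where "g = inv_into {..<q} h"
  have g: "bij_betw g UNIV {..<q}"
    unfolding g_def by (rule bij_betw_inv_into[OF h])
  define P where "P x i = (if i < q then g (F x (h i)) else i)" for x i
  have perm: "P x permutes {..<q}" if "x \<in> X" for x
  proof (rule bij_imp_permutes)
    have "bij (F x)"
      using inj[OF that] by (simp add: bij_def finite_UNIV_inj_surj)
    then have "bij_betw (g \<circ> (F x \<circ> h)) {..<q} {..<q}"
      using h g by (intro bij_betw_trans)
    then show "bij_betw (P x) {..<q} {..<q}"
      by (rule bij_betw_cong[THEN iffD1, rotated]) (simp add: P_def)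
  qed (simp add: P_def)
  have dist: "q - m \<le> hamming_dist q (P x) (P y)" if "x \<in> X" "y \<in> X" "x \<noteq> y" for x y
  proof -
    \<comment> \<open>Relabelling positions by \<open>h\<close> and values by the injective
      \<open>g\<close> preserves disagreements.\<close>
    have "bij_betw h {i \<in> {..<q}. P x i \<noteq> P y i} {a. F x a \<noteq> F y a}"
    proof (rule bij_betw_subset[OF h, THEN bij_betw_cong[THEN iffD1, rotated]])
      show "h ` {i \<in> {..<q}. P x i \<noteq> P y i} = {a. F x a \<noteq> F y a}"
        using h bij_betw_imp_inj_on[OF g] by (auto simp: P_def inj_eq bij_betw_def image_iff)
    qed auto
    then have "hamming_dist q (P x) (P y) = card {a. F x a \<noteq> F y a}"
      unfolding hamming_dist_def by (rule bij_betw_same_card)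
    also have "{a. F x a \<noteq> F y a} = UNIV - {a. F x a = F y a}" by auto
    also have "card \<dots> = q - card {a. F x a = F y a}"
      by (simp add: card_Diff_subset q)
    finally show ?thesis using agree[OF that] by simp
  qed
  have "inj_on P X"
  proof (rule inj_onI, rule ccontr)
    fix x y assume "x \<in> X" "y \<in> X" "P x = P y" "x \<noteq> y"
    with dist[of x y] \<open>m < q\<close> show False by (simp add: hamming_dist_def)
  qed
  then have "card X = card (P ` X)" by (simp add: card_image)
  also have "\<dots> \<le> M q (q - m)"
    using perm dist by (intro card_le_M) (auto simp: is_perm_array_def)
  finally show ?thesis .
qed

theorem theorem4p10:
  fixes d q :: nat
  assumes "odd d" and "d \<ge> 3"
    and "primepow q" and "q \<ge> d + 2"
    and "card (UNIV :: 'a::{field,finite} set) = q"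
  shows "M q (q - d - 1) \<ge>
           S_PRF TYPE('a) d + N_monic TYPE('a) ((d + 3) div 2) ((d + 1) div 2)"
proof -
  define A :: "'a poly fract set" where "A = (\<Union>(v, u)\<in>S_index d. PRFs v u)"
  define B :: "'a poly fract set" where "B = monic_PRFs ((d + 3) div 2) ((d + 1) div 2)"
  \<comment> \<open>For odd \<open>d\<close> the doubled numerator degree is \<open>d + 3\<close>,
    beyond the bound \<open>d + 1\<close>.\<close>
  have "((d + 3) div 2, (d + 1) div 2) \<notin> S_index d"
    using \<open>odd d\<close> by (auto simp: S_index_def elim!: oddE)
  then have "PRFs v u \<inter> B = {}" if "(v, u) \<in> S_index d" for v u
    using PRFs_disjoint[of v u "(d + 3) div 2" "(d + 1) div 2"] monic_PRFs_subset that
    unfolding B_def by blast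
  then have "A \<inter> B = {}" by (auto simp: A_def)
  moreover have "finite A" "finite B"
    unfolding A_def B_def
    by (auto simp: finite_S_index finite_PRFs intro: finite_subset[OF monic_PRFs_subset])
  ultimately have "card (A \<union> B) = card A + card B" by (rule card_Un_disjoint[rotated 2])
  moreover have "card A = S_PRF TYPE('a) d"
  proof -
    have "card A = (\<Sum>i\<in>S_index d. card ((case i of (v, u) \<Rightarrow> PRFs v u) :: 'a poly fract set))"
      unfolding A_def
    proof (rule card_UN_disjoint[OF finite_S_index])
      show "\<forall>i\<in>S_index d. \<forall>j\<in>S_index d. i \<noteq> j \<longrightarrow>
          ((case i of (v, u) \<Rightarrow> PRFs v u) :: 'a poly fract set) \<inter> (case j of (v, u) \<Rightarrow> PRFs v u) = {}"
        by (simp add: PRFs_disjoint split: prod.splits)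
    qed (auto simp: finite_PRFs)
    then show ?thesis by (simp add: S_PRF_def N_PRF_def case_prod_unfold)
  qed
  ultimately have card: "card (A \<union> B) =
      S_PRF TYPE('a) d + N_monic TYPE('a) ((d + 3) div 2) ((d + 1) div 2)"
    by (simp add: N_monic_def B_def)
  have "\<exists>V U. x = Fract V U \<and> admissible d V U" if "x \<in> A \<union> B" for x
    using that unfolding A_def B_def PRFs_def monic_PRFs_def admissible_def by blast
  \<comment> \<open>Evaluation acts on pairs, so one representative is fixed per fraction; for
    members of \<open>B\<close> admissibility makes it the monic one.\<close>
  then obtain num den where rep: "\<And>x. x \<in> A \<union> B \<Longrightarrow> x = Fract (num x) (den x)"
    and adm: "\<And>x. x \<in> A \<union> B \<Longrightarrow> admissible d (num x) (den x)"
    by metis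
  have "card (A \<union> B) \<le> M q (q - (d + 1))"
  proof (rule card_le_M_of_agree_le[OF assms(5), where F = "\<lambda>x. contract (ratfun_eval (num x) (den x))"])
    show "inj (contract (ratfun_eval (num x) (den x)))" if "x \<in> A \<union> B" for x
      using adm[OF that] by (auto simp: admissible_def is_PRF_def intro: inj_contract bij_is_inj)
    show "card {a. contract (ratfun_eval (num x) (den x)) a = contract (ratfun_eval (num y) (den y)) a}
        \<le> d + 1" if "x \<in> A \<union> B" "y \<in> A \<union> B" "x \<noteq> y" for x y
    proof -
      have is_PRF: "is_PRF (num x) (den x)" "is_PRF (num y) (den y)"
        using adm that by (auto simp: admissible_def)
      have "Fract (num x) (den x) \<noteq> Fract (num y) (den y)"
        using rep[OF that(1)] rep[OF that(2)] that(3) by argo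
      then have "num x * den y \<noteq> den x * num y"
        by (simp add: Fract_eq_PRF_iff[OF is_PRF])
      from card_contract_agree_le[OF is_PRF this]
        degree_cross_diff_le[OF \<open>odd d\<close> adm[OF that(1)] adm[OF that(2)]]
      show ?thesis by (rule order_trans)
    qed
  qed (use \<open>q \<ge> d + 2\<close> in simp)
  with card show ?thesis by simp
qed

end
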